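(* For every integer $n\geq 1$, $$\left\lfloor\frac{3n+1}{4}\right\rfloor\leq \mu(n)\leq \left\lceil\frac{3n}{4}\right\rceil.$$
   Context: For finite sets $A,I$, a language is a subset $L\subseteq A^I$. For finite sets $B,J$ and a function $f:B^J\to A^I$, the input window $\mathcal{W}_f(i)\subseteq J$ of $i\in I$ is the smallest $W\subseteq J$ such that for all $x,y\in B^J$ agreeing on $W$, $f(x)_i=f(y)_i$. The communication complex $K_f$ is the simplicial complex on vertex set $I$ whose simplices are the sets $S\subseteq I$ with $\bigcap_{i\in S}\mathcal{W}_f(i)\neq\emptyset$. A simplicial complex $K$ on $I$ generates $L$ if there exist finite sets $B,J$ and $f:B^J\to A^I$ with $f(B^J)=L$ and $K_f\subseteq K$. $\mathsf{Mon}_n\subseteq\{0,1\}^n$ is the set of binary strings $x_0\ldots x_{n-1}$ that are non-decreasing or non-increasing. Positions $I_n=\{0,\ldots,n-1\}$ are identified with $\mathbb{Z}/n\mathbb{Z}$. For $a,b\in\mathbb{Z}$, the interval $[\![a,b]\!]=\{c\bmod n: c\in\mathbb{Z},\ a\leq c\leq b'\}$ where $b'$ is the representative of $b$ modulo $n$ with $a\leq b'<a+n$; its size is $1+((b-a)\bmod n)$. $\mu(n)$ is the minimal $k$ such that there exists a simplicial complex on $I_n$ generating $\mathsf{Mon}_n$ all of whose simplices that are intervals have size at most $k$. *)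

theory Defs
  imports Complex_Main "HOL-Library.FuncSet"
begin

text \<open>The set of functions from I to A is the extensional function space I \<open>\<rightarrow>\<^sub>E\<close> A.\<close>

definition language :: "'a set \<Rightarrow> 'i set \<Rightarrow> ('i \<Rightarrow> 'a) set \<Rightarrow> bool" where
  "language A I L \<longleftrightarrow> finite A \<and> finite I \<and> L \<subseteq> (I \<rightarrow>\<^sub>E A)"

definition determines ::
  "'b set \<Rightarrow> 'j set \<Rightarrow> (('j \<Rightarrow> 'b) \<Rightarrow> ('i \<Rightarrow> 'a)) \<Rightarrow> 'i \<Rightarrow> 'j set \<Rightarrow> bool" where
  "determines B J f i W \<longleftrightarrow>
     W \<subseteq> J \<and> (\<forall>x\<in>J \<rightarrow>\<^sub>E B. \<forall>y\<in>J \<rightarrow>\<^sub>E B. (\<forall>j\<in>W. x j = y j) \<longrightarrow> f x i = f y i)"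

text \<open>Least with respect to inclusion. It exists by \<open>input_window_least\<close> below.\<close>

definition input_window ::
  "'b set \<Rightarrow> 'j set \<Rightarrow> (('j \<Rightarrow> 'b) \<Rightarrow> ('i \<Rightarrow> 'a)) \<Rightarrow> 'i \<Rightarrow> 'j set" where
  "input_window B J f i = (LEAST W. determines B J f i W)"

text \<open>The empty simplex belongs to every complex (the intersection of the empty family is
  \<open>UNIV\<close>, so it also belongs to every communication complex). A point of I need not be a
  simplex: a position with an empty input window is not one in the communication complex.\<close>

definition simplicial_complex :: "'i set \<Rightarrow> 'i set set \<Rightarrow> bool" where
  "simplicial_complex I K \<longleftrightarrow> K \<subseteq> Pow I \<and> {} \<in> K \<and> (\<forall>S\<in>K. \<forall>T\<subseteq>S. T \<in> K)"

definition communication_complex ::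
  "'i set \<Rightarrow> 'b set \<Rightarrow> 'j set \<Rightarrow> (('j \<Rightarrow> 'b) \<Rightarrow> ('i \<Rightarrow> 'a)) \<Rightarrow> 'i set set" where
  "communication_complex I B J f = {S. S \<subseteq> I \<and> (\<Inter>i\<in>S. input_window B J f i) \<noteq> {}}"

text \<open>The finite sets B and J range over finite sets of natural numbers, because HOL does not
  quantify over types inside a formula. Lemma \<open>generates_any_type\<close> below shows that finite sets
  of arbitrary types yield nothing more.\<close>

definition generates :: "'a set \<Rightarrow> 'i set \<Rightarrow> 'i set set \<Rightarrow> ('i \<Rightarrow> 'a) set \<Rightarrow> bool" where
  "generates A I K L \<longleftrightarrow>
     language A I L \<and> simplicial_complex I K \<and>
     (\<exists>(B :: nat set) (J :: nat set) f.
        finite B \<and> finite J \<and> f \<in> (J \<rightarrow>\<^sub>E B) \<rightarrow> (I \<rightarrow>\<^sub>E A) \<and>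
        f ` (J \<rightarrow>\<^sub>E B) = L \<and> communication_complex I B J f \<subseteq> K)"

definition Mon :: "nat \<Rightarrow> (nat \<Rightarrow> nat) set" where
  "Mon n = {x \<in> {0..<n} \<rightarrow>\<^sub>E {0, 1}. mono_on {0..<n} x \<or> antimono_on {0..<n} x}"

text \<open>For n > 0, the representative of b modulo n that lies in {a..<a+n} is
  a + (b - a) mod n.\<close>

definition cyclic_interval :: "nat \<Rightarrow> int \<Rightarrow> int \<Rightarrow> nat set" where
  "cyclic_interval n a b = {nat (c mod int n) | c. a \<le> c \<and> c \<le> a + (b - a) mod int n}"

definition mu :: "nat \<Rightarrow> nat" where
  "mu n = (LEAST k. \<exists>K. generates {0, 1} {0..<n} K (Mon n) \<and>
             (\<forall>S\<in>K. (\<exists>a b. S = cyclic_interval n a b) \<longrightarrow> card S \<le> k))"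

lemma determines_subset: "determines B J f i W \<Longrightarrow> W \<subseteq> J"
  unfolding determines_def by blast

lemma determines_Int:
  assumes "determines B J f i V" "determines B J f i W"
  shows "determines B J f i (V \<inter> W)"
  unfolding determines_def
proof (intro conjI ballI impI)
  show "V \<inter> W \<subseteq> J" using assms by (blast dest: determines_subset)
  fix x y assume xy: "x \<in> J \<rightarrow>\<^sub>E B" "y \<in> J \<rightarrow>\<^sub>E B" "\<forall>j\<in>V \<inter> W. x j = y j"
  define z where "z = (\<lambda>j. if j \<in> V then x j else y j)"
  have V: "V \<subseteq> J" using assms by (blast dest: determines_subset)
  have z: "z \<in> J \<rightarrow>\<^sub>E B"
  proof (rule PiE_I)
    show "z j \<in> B" if "j \<in> J" for j
      using PiE_mem[OF xy(1) that] PiE_mem[OF xy(2) that] by (simp add: z_def)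
    show "z j = undefined" if "j \<notin> J" for j
      using PiE_arb[OF xy(2) that] V that by (auto simp: z_def)
  qed
  have "f x i = f z i"
  proof -
    have "\<forall>j\<in>V. x j = z j" by (simp add: z_def)
    then show ?thesis using assms(1) xy(1) z unfolding determines_def by blast
  qed
  also have "f z i = f y i"
  proof -
    have "\<forall>j\<in>W. z j = y j" using xy(3) by (auto simp: z_def)
    then show ?thesis using assms(2) xy(2) z unfolding determines_def by blast
  qed
  finally show "f x i = f y i" .
qed

lemma input_window_least:
  assumes "finite J"
  shows "determines B J f i (input_window B J f i)"
    and "determines B J f i W \<Longrightarrow> input_window B J f i \<subseteq> W"
proof -
  let ?D = "{W. determines B J f i W}"
  have J: "J \<in> ?D"
  proof -
    have "f x i = f y i" if "x \<in> J \<rightarrow>\<^sub>E B" "y \<in> J \<rightarrow>\<^sub>E B" "\<forall>j\<in>J. x j = y j" for x y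
      using PiE_ext[OF that(1,2)] that(3) by simp
    then show ?thesis unfolding determines_def by blast
  qed
  have fin: "finite ?D"
    by (rule finite_subset[of _ "Pow J"]) (use assms in \<open>auto dest: determines_subset\<close>)
  have "F \<noteq> {} \<longrightarrow> F \<subseteq> ?D \<longrightarrow> \<Inter>F \<in> ?D" if "finite F" for F
    using that by (induction F) (auto simp: determines_Int)
  then have 1: "determines B J f i (\<Inter>?D)" using fin J by blast
  have eq: "input_window B J f i = \<Inter>?D"
    unfolding input_window_def by (rule Least_equality) (use 1 in auto)
  show "determines B J f i (input_window B J f i)" using 1 eq by simp
  show "determines B J f i W \<Longrightarrow> input_window B J f i \<subseteq> W" using eq by auto
qed

lemma generates_any_type:
  fixes B :: "'b set" and J :: "'j set" and f :: "('j \<Rightarrow> 'b) \<Rightarrow> ('i \<Rightarrow> 'a)"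
  assumes L: "language A I L" and K: "simplicial_complex I K"
    and fin: "finite B" "finite J"
    and f: "f ` (J \<rightarrow>\<^sub>E B) = L" "communication_complex I B J f \<subseteq> K"
  shows "generates A I K L"
proof -
  obtain h :: "'b \<Rightarrow> nat" where h: "inj_on h B"
    using finite_imp_inj_to_nat_seg[OF fin(1)] by blast
  obtain g :: "'j \<Rightarrow> nat" where g: "inj_on g J"
    using finite_imp_inj_to_nat_seg[OF fin(2)] by blast
  define p where "p = (\<lambda>y :: nat \<Rightarrow> nat. \<lambda>j\<in>J. inv_into B h (y (g j)))"
  define f' where "f' = (\<lambda>y. f (p y))"
  let ?B = "h ` B" and ?J = "g ` J"
  have p: "p y \<in> J \<rightarrow>\<^sub>E B" if "y \<in> ?J \<rightarrow>\<^sub>E ?B" for y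
    using that by (auto simp: p_def PiE_iff intro!: inv_into_into)
  have "\<exists>y \<in> ?J \<rightarrow>\<^sub>E ?B. p y = x" if "x \<in> J \<rightarrow>\<^sub>E B" for x
  proof
    let ?y = "\<lambda>k\<in>?J. h (x (inv_into J g k))"
    show "?y \<in> ?J \<rightarrow>\<^sub>E ?B" using that g by (auto simp: PiE_iff)
    show "p ?y = x"
    proof
      fix j show "p ?y j = x j"
        using that g h by (cases "j \<in> J") (auto simp: p_def PiE_iff extensional_def)
    qed
  qed
  then have pimg: "p ` (?J \<rightarrow>\<^sub>E ?B) = J \<rightarrow>\<^sub>E B" using p by blast
  have img: "f' ` (?J \<rightarrow>\<^sub>E ?B) = L"
  proof -
    have "f' ` (?J \<rightarrow>\<^sub>E ?B) = f ` p ` (?J \<rightarrow>\<^sub>E ?B)" by (simp only: f'_def image_image)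
    also have "\<dots> = L" by (simp only: pimg f(1))
    finally show ?thesis .
  qed
  have win: "input_window ?B ?J f' i \<subseteq> g ` input_window B J f i" for i
  proof (rule input_window_least(2))
    let ?W = "input_window B J f i"
    have W: "determines B J f i ?W" by (rule input_window_least(1)[OF fin(2)])
    then have WJ: "?W \<subseteq> J" by (rule determines_subset)
    show "determines ?B ?J f' i (g ` ?W)"
      unfolding determines_def
    proof (intro conjI ballI impI)
      show "g ` ?W \<subseteq> g ` J" using WJ by auto
      fix x y assume xy: "x \<in> ?J \<rightarrow>\<^sub>E ?B" "y \<in> ?J \<rightarrow>\<^sub>E ?B" "\<forall>j\<in>g ` ?W. x j = y j"
      have "\<forall>j\<in>?W. p x j = p y j" using xy(3) by (auto simp: p_def restrict_def)
      then show "f' x i = f' y i"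
        using W p[OF xy(1)] p[OF xy(2)] unfolding f'_def determines_def by blast
    qed
  qed (use fin in simp)
  have "communication_complex I ?B ?J f' \<subseteq> communication_complex I B J f"
  proof
    fix S assume S: "S \<in> communication_complex I ?B ?J f'"
    then obtain k where k: "\<And>i. i \<in> S \<Longrightarrow> k \<in> input_window ?B ?J f' i"
      by (auto simp: communication_complex_def)
    have WJ: "input_window B J f i \<subseteq> J" for i
      using determines_subset[OF input_window_least(1)[OF fin(2)]] .
    have "inv_into J g k \<in> input_window B J f i" if i: "i \<in> S" for i
    proof -
      obtain j where "j \<in> input_window B J f i" "k = g j" using win k[OF i] by blast
      then show ?thesis using WJ[of i] g by (metis inv_into_f_f subsetD)
    qed
    then have "inv_into J g k \<in> (\<Inter>i\<in>S. input_window B J f i)" by blast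
    then show "S \<in> communication_complex I B J f"
      using S unfolding communication_complex_def by blast
  qed
  then have "communication_complex I ?B ?J f' \<subseteq> K" using f(2) by (rule subset_trans)
  moreover have "f' \<in> (?J \<rightarrow>\<^sub>E ?B) \<rightarrow> (I \<rightarrow>\<^sub>E A)"
    using img L unfolding language_def by blast
  ultimately have "finite ?B \<and> finite ?J \<and> f' \<in> (?J \<rightarrow>\<^sub>E ?B) \<rightarrow> (I \<rightarrow>\<^sub>E A) \<and>
      f' ` (?J \<rightarrow>\<^sub>E ?B) = L \<and> communication_complex I ?B ?J f' \<subseteq> K"
    using fin img by (intro conjI finite_imageI)
  then show ?thesis unfolding generates_def using L K by blast
qed

end

theory Submission
  imports Defs
begin

text \<open>
  The words of \<open>Mon n\<close> form a circle of 2n states: passing from state t to state t + 1 flips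
  bit t mod n. A change of input j alone moves the state along an arc that crosses no position
  outside of its influence.

  Lower bound. Fix k with 4k + 3 \<le> 3n and suppose that every k + 1 consecutive positions contain
  one that ignores j, for each input j. Call j separating at s if it is ignored by a position on
  each of the two arcs from state s to the opposite position. Starting in state s, arbitrary
  changes of the separating inputs keep the state in an interval [l(s), r(s)] of length at most k:
  these states are told apart by a chain of Boolean functions, and interpolation provides one
  separating input that all of them read. Every input is separating at s or at s + k + 1, so one can
  combine an input vector of state s with one of state s + k + 1 and obtain
  l(s + k + 1) \<le> r(s). Hence s - l(s) increases by at least 1 with each step s \<mapsto> s + k + 1,
  although it is bounded by k.

  Upper bound. Four inputs suffice, where the d-th quarter of the positions ignores input d.
\<close>

subsection \<open>Lower bound\<close>

definition depends_only :: "('j \<Rightarrow> 'b) set \<Rightarrow> 'j set \<Rightarrow> (('j \<Rightarrow> 'b) \<Rightarrow> bool) \<Rightarrow> bool" where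
  "depends_only S W g \<longleftrightarrow> (\<forall>y\<in>S. \<forall>z\<in>S. (\<forall>j\<in>W. y j = z j) \<longrightarrow> g y = g z)"

text \<open>The part of the product structure that interpolation needs. It passes to boxes in which
  some inputs are frozen.\<close>

definition mix_closed :: "('j \<Rightarrow> 'b) set \<Rightarrow> bool" where
  "mix_closed S \<longleftrightarrow> (\<forall>y\<in>S. \<forall>z\<in>S. \<forall>U. (\<lambda>j. if j \<in> U then y j else z j) \<in> S)"

lemma mix_closedD: "mix_closed S \<Longrightarrow> y \<in> S \<Longrightarrow> z \<in> S \<Longrightarrow> (\<lambda>j. if j \<in> U then y j else z j) \<in> S"
  unfolding mix_closed_def by blast

lemma depends_onlyD:
  "depends_only S W g \<Longrightarrow> y \<in> S \<Longrightarrow> z \<in> S \<Longrightarrow> (\<And>j. j \<in> W \<Longrightarrow> y j = z j) \<Longrightarrow> g y = g z"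
  unfolding depends_only_def by blast

text \<open>Between consecutive functions of a decreasing chain there is an interpolant that depends only on
  the common inputs of the two. It is again non-constant, so the chain can be shortened.\<close>

lemma chain_common_input:
  assumes mix: "mix_closed S"
    and "\<And>i. i \<le> r \<Longrightarrow> depends_only S (W i) (b i)"
    and "\<And>i. i \<le> r \<Longrightarrow> \<exists>y\<in>S. b i y"
    and "\<And>i. i \<le> r \<Longrightarrow> \<exists>y\<in>S. \<not> b i y"
    and "\<And>i y. i < r \<Longrightarrow> y \<in> S \<Longrightarrow> b (Suc i) y \<Longrightarrow> b i y"
  shows "\<exists>j. \<forall>i\<le>r. j \<in> W i"
  using assms(2-)
proof (induction r arbitrary: W b)
  case 0
  obtain y z where "y \<in> S" "b 0 y" "z \<in> S" "\<not> b 0 z" using 0(2,3) by blast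
  then have "W 0 \<noteq> {}" using depends_onlyD[OF 0(1)[of 0], of y z] by auto
  then show ?case by auto
next
  case (Suc r)
  define W' where "W' i = W i \<inter> W (Suc i)" for i
  \<comment> \<open>Craig interpolant between \<open>b (Suc i)\<close> and \<open>b i\<close>: the
    inputs that are not common are projected away.\<close>
  define b' where "b' i y \<longleftrightarrow> (\<exists>z\<in>S. (\<forall>j\<in>W' i. z j = y j) \<and> b (Suc i) z)" for i y
  have lower: "b' i y" if "b (Suc i) y" "y \<in> S" for i y
    using that unfolding b'_def by blast
  have upper: "b i y" if i: "i \<le> r" and y: "y \<in> S" "b' i y" for i y
  proof -
    obtain z where z: "z \<in> S" "\<And>j. j \<in> W' i \<Longrightarrow> z j = y j" "b (Suc i) z"
      using y(2) unfolding b'_def by blast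
    \<comment> \<open>\<open>?u\<close> agrees with \<open>z\<close> on \<open>W (Suc i)\<close> and
      with \<open>y\<close> on \<open>W i\<close>, because \<open>z\<close> and \<open>y\<close>
      agree on the common inputs.\<close>
    let ?u = "\<lambda>j. if j \<in> W (Suc i) then z j else y j"
    have u: "?u \<in> S" using mix_closedD[OF mix z(1) y(1)] .
    have "b (Suc i) ?u"
      using depends_onlyD[OF Suc.prems(1)[of "Suc i"], of z ?u] z u i by auto
    then have "b i ?u" using Suc.prems(4)[of i] i u by simp
    then show ?thesis
      using depends_onlyD[OF Suc.prems(1)[of i], of y ?u] z(2) u y(1) i by (auto simp: W'_def)
  qed
  have "\<exists>j. \<forall>i\<le>r. j \<in> W' i"
  proof (rule Suc.IH[of W' b'])
    show "depends_only S (W' i) (b' i)" for i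
      unfolding depends_only_def b'_def by auto
    show "\<exists>y\<in>S. b' i y" if "i \<le> r" for i
      using Suc.prems(2)[of "Suc i"] that lower by blast
    show "\<exists>y\<in>S. \<not> b' i y" if "i \<le> r" for i
      using Suc.prems(3)[of i] that upper by fastforce
    show "b' i y" if "i < r" "y \<in> S" "b' (Suc i) y" for i y
      using upper[of "Suc i" y] lower[of i y] that by simp
  qed
  then obtain j where j: "\<And>i. i \<le> r \<Longrightarrow> j \<in> W i \<inter> W (Suc i)" unfolding W'_def by blast
  have "j \<in> W i" if "i \<le> Suc r" for i
    using j[of i] j[of "i - 1"] that by (cases i) auto
  then show ?case by blast
qed

section \<open>States and bits on the unrolled circle\<close>

text \<open>Positions are unrolled to the integers, with bits negated after each turn: the bit at position
  i + n is the negation of the bit at position i. Then state t has bit 1 exactly at the positions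
  t - n, \<dots>, t - 1, up to multiples of 2n.\<close>

locale cyclic_process =
  fixes n k :: nat and J :: "'j set" and S :: "('j \<Rightarrow> 'b) set"
    and b :: "int \<Rightarrow> ('j \<Rightarrow> 'b) \<Rightarrow> bool" and V :: "int \<Rightarrow> 'j set"
  assumes finJ: "finite J"
    and mix: "mix_closed S"
    and off: "x \<in> S \<Longrightarrow> y \<in> S \<Longrightarrow> j \<notin> J \<Longrightarrow> x j = y j"
    and V_J: "V i \<subseteq> J"
    and dep: "depends_only S (V i) (b i)"
    and V_periodic: "V (i + int n) = V i"
    and state: "x \<in> S \<Longrightarrow> \<exists>t. \<forall>i. b i x \<longleftrightarrow> even ((t - 1 - i) div int n)"
    and onto: "\<exists>x\<in>S. \<forall>i. b i x \<longleftrightarrow> even ((t - 1 - i) div int n)"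
    and gap: "j \<in> J \<Longrightarrow> \<exists>i\<in>{a..a + int k}. j \<notin> V i"
    and k_le: "4 * k + 3 \<le> 3 * n" and k_ge: "3 * n < 4 * k + 7"
begin

lemma n_pos: "0 < n" using k_le by simp

definition in_state :: "('j \<Rightarrow> 'b) \<Rightarrow> int \<Rightarrow> bool" where
  "in_state x t \<longleftrightarrow> (\<forall>i. b i x \<longleftrightarrow> even ((t - 1 - i) div int n))"

lemma in_state_bit:
  assumes "in_state x t" "t - int n \<le> i" "i < t + int n"
  shows "b i x \<longleftrightarrow> i < t"
proof (cases "i < t")
  case True
  then have "(t - 1 - i) div int n = 0" using assms by (intro div_pos_pos_trivial) auto
  then show ?thesis using assms(1) True unfolding in_state_def by simp
next
  case False
  then have "(t - 1 - i) div int n = -1" using assms n_pos by (intro int_div_pos_eq[of _ _ _ "t - 1 - i + int n"]) auto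
  then show ?thesis using assms(1) False unfolding in_state_def by simp
qed

lemma bit_periodic:
  assumes "x \<in> S"
  shows "b (i + int n) x \<longleftrightarrow> \<not> b i x"
proof -
  obtain t where t: "\<And>i. b i x \<longleftrightarrow> even ((t - 1 - i) div int n)" using state[OF assms] by blast
  have "(t - 1 - i) div int n = (t - 1 - (i + int n)) div int n + 1"
    using n_pos div_add_self2[of "int n" "t - 1 - (i + int n)"] by (simp add: algebra_simps)
  then show ?thesis unfolding t by simp
qed

lemma in_state_shift: "in_state x t \<Longrightarrow> in_state x (t + 2 * int n * m)"
proof -
  have "(t + 2 * int n * m - 1 - i) div int n = (t - 1 - i) div int n + 2 * m" for i
    using n_pos div_mult_self2[of "int n" "t - 1 - i" "2 * m"] by (simp add: algebra_simps)
  then show "in_state x t \<Longrightarrow> in_state x (t + 2 * int n * m)" unfolding in_state_def by simp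
qed

text \<open>One bit separates the two states: the one at \<open>u - 1\<close> if \<open>u\<close> is
  at most half a turn ahead of \<open>t\<close>, the one at \<open>t - 1\<close> otherwise.\<close>

lemma in_state_less_unique:
  assumes "in_state x t" "in_state x u" "t < u" "u < t + 2 * int n"
  shows False
proof (cases "u \<le> t + int n")
  case True
  then show ?thesis using in_state_bit[OF assms(1), of "u - 1"] in_state_bit[OF assms(2), of "u - 1"] assms by auto
next
  case False
  then have "(u - 1 - (t - 1)) div int n = 1"
    using assms by (intro int_div_pos_eq[of _ _ _ "u - t - int n"]) auto
  then have "\<not> b (t - 1) x" using assms(2) unfolding in_state_def by (metis odd_one)
  then show ?thesis using in_state_bit[OF assms(1), of "t - 1"] n_pos by auto
qed

lemma in_state_unique: "in_state x t \<Longrightarrow> in_state x u \<Longrightarrow> \<bar>t - u\<bar> < 2 * int n \<Longrightarrow> t = u"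
  using in_state_less_unique[of x t u] in_state_less_unique[of x u t] by (cases t u rule: linorder_cases) auto

text \<open>A bit that is 0 cuts the circle open and leaves half a turn, on which states are
  linearly ordered.\<close>

lemma in_state_in_window:
  assumes "x \<in> S" "\<not> b g x"
  shows "\<exists>t. g - int n < t \<and> t \<le> g \<and> in_state x t"
proof -
  obtain t where "in_state x t" using state[OF assms(1)] unfolding in_state_def by blast
  \<comment> \<open>\<open>u\<close> represents \<open>t\<close> modulo \<open>2 * n\<close> in the
    full turn ending at \<open>g\<close>. The bit at \<open>g - n\<close>, opposite to that at
    \<open>g\<close>, then excludes the lower half.\<close>
  define m where "m = (t - (g - 2 * int n + 1)) div (2 * int n)"
  define u where "u = t + 2 * int n * (- m)"
  have u: "in_state x u" unfolding u_def by (rule in_state_shift) fact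
  have "u = g - 2 * int n + 1 + (t - (g - 2 * int n + 1)) mod (2 * int n)"
    unfolding u_def m_def using minus_mult_div_eq_mod[of "t - (g - 2 * int n + 1)" "2 * int n"]
    by (simp add: algebra_simps)
  moreover have "0 \<le> (t - (g - 2 * int n + 1)) mod (2 * int n)"
    "(t - (g - 2 * int n + 1)) mod (2 * int n) < 2 * int n" using n_pos by simp_all
  ultimately have range: "g - 2 * int n < u" "u \<le> g" by linarith+
  have "g - int n < u"
  proof (rule ccontr)
    assume "\<not> g - int n < u"
    then have "b (g - int n) x \<longleftrightarrow> False"
      using in_state_bit[OF u, of "g - int n"] range by auto
    then show False using bit_periodic[OF assms(1), of "g - int n"] assms(2) by simp
  qed
  then show ?thesis using u range by blast
qed

definition box :: "('j \<Rightarrow> 'b) \<Rightarrow> 'j set \<Rightarrow> ('j \<Rightarrow> 'b) set" where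
  "box x P = {y \<in> S. \<forall>j. j \<notin> P \<longrightarrow> y j = x j}"

lemma mix_closed_box: "mix_closed (box x P)"
  using mix unfolding mix_closed_def box_def by auto

text \<open>The bits between the extreme states form a decreasing chain, none constant on the box
  since each differs at the two extremes. \<open>chain_common_input\<close> yields one released
  input that all of them read.\<close>

lemma box_states:
  assumes x: "x \<in> S" and const: "\<And>y. y \<in> box x P \<Longrightarrow> \<not> b g y"
  obtains l r where "g - int n < l" "l \<le> r" "r \<le> g"
    "\<And>y. y \<in> box x P \<Longrightarrow> \<exists>t\<in>{l..r}. in_state y t"
    "l = r \<or> (\<exists>j\<in>P. \<forall>i\<in>{l..<r}. j \<in> V i)"
proof -
  define T where "T = {t \<in> {g - int n<..g}. \<exists>y\<in>box x P. in_state y t}"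
  have fin: "finite T" unfolding T_def by (rule finite_subset[of _ "{g - int n<..g}"]) auto
  have ex: "\<exists>t\<in>T. in_state y t" if "y \<in> box x P" for y
    using in_state_in_window[OF _ const[OF that]] that unfolding T_def box_def by auto
  have "x \<in> box x P" using x unfolding box_def by simp
  then have ne: "T \<noteq> {}" using ex by blast
  define l r where "l = Min T" and "r = Max T"
  have lr: "l \<in> T" "r \<in> T" "\<And>t. t \<in> T \<Longrightarrow> l \<le> t \<and> t \<le> r"
    unfolding l_def r_def using fin ne by auto
  have bit: "b i y \<longleftrightarrow> i < t" if "t \<in> T" "in_state y t" "l \<le> i" "i < r" for i t y
    using in_state_bit[OF that(2), of i] that lr unfolding T_def by auto
  have "\<exists>j\<in>P. \<forall>i\<in>{l..<r}. j \<in> V i" if "l < r"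
  proof -
    define q where "q = nat (r - l) - 1"
    have q: "l + int i < r" if "i \<le> q" for i using that \<open>l < r\<close> unfolding q_def by linarith
    obtain yl yr where y: "yl \<in> box x P" "in_state yl l" "yr \<in> box x P" "in_state yr r"
      using lr(1,2) unfolding T_def by auto
    have "\<exists>j. \<forall>i\<le>q. j \<in> V (l + int i) \<inter> P"
    proof (rule chain_common_input[OF mix_closed_box[of x P]])
      show "depends_only (box x P) (V (l + int i) \<inter> P) (b (l + int i))" for i
        unfolding depends_only_def
      proof (intro ballI impI)
        fix y z assume yz: "y \<in> box x P" "z \<in> box x P" "\<forall>j\<in>V (l + int i) \<inter> P. y j = z j"
        then have "y j = z j" if "j \<in> V (l + int i)" for j
          using that unfolding box_def by (cases "j \<in> P") auto
        then show "b (l + int i) y = b (l + int i) z"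
          using depends_onlyD[OF dep, of y z] yz(1,2) unfolding box_def by simp
      qed
      show "\<exists>y\<in>box x P. b (l + int i) y" if "i \<le> q" for i
        using bit[OF lr(2) y(4), of "l + int i"] q[OF that] y(3) by auto
      show "\<exists>y\<in>box x P. \<not> b (l + int i) y" if "i \<le> q" for i
        using bit[OF lr(1) y(2), of "l + int i"] q[OF that] y(1) by auto
      show "b (l + int i) y" if y: "i < q" "y \<in> box x P" "b (l + int (Suc i)) y" for i y
      proof -
        obtain t where t: "t \<in> T" "in_state y t" using ex[OF y(2)] by blast
        show ?thesis
          using bit[OF t, of "l + int i"] bit[OF t, of "l + int (Suc i)"] q[of i] q[of "Suc i"] y by auto
      qed
    qed
    then obtain j where j: "\<And>i. i \<le> q \<Longrightarrow> j \<in> V (l + int i) \<inter> P" by blast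
    have "j \<in> V i" if "i \<in> {l..<r}" for i
      using j[of "nat (i - l)"] that unfolding q_def by (auto simp: nat_le_iff nat_diff_distrib)
    then show ?thesis using j[of 0] by blast
  qed
  moreover have "l \<le> r" using lr(1,3) by blast
  moreover have "\<exists>t\<in>{l..r}. in_state y t" if y: "y \<in> box x P" for y
  proof -
    obtain t where "t \<in> T" "in_state y t" using ex[OF y] by blast
    then show ?thesis using lr(3)[of t] by auto
  qed
  moreover have "g - int n < l" "r \<le> g" using lr(1,2) unfolding T_def by auto
  ultimately show ?thesis using that[of l r] by (cases "l = r") simp_all
qed

section \<open>Separating inputs and the contradiction\<close>

text \<open>State \<open>s\<close> sits between positions \<open>s - 1\<close> and \<open>s\<close>.
  The two arcs share the opposite position, since \<open>s + n div 2\<close> and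
  \<open>s + n div 2 - n\<close> agree modulo \<open>n\<close>.\<close>

definition separating :: "int \<Rightarrow> 'j set" where
  "separating s = {j \<in> J. (\<exists>i\<in>{s..s + int (n div 2)}. j \<notin> V i) \<and>
     (\<exists>i\<in>{s + int (n div 2) - int n..s - 1}. j \<notin> V i)}"

text \<open>Unless \<open>l = r\<close>, one separating input is read at all positions from
  \<open>l\<close> to \<open>r - 1\<close>. By \<open>gap\<close> there are at most \<open>k\<close>
  of them, and the positions ignoring this input on either arc stop the interval.\<close>

lemma separating_states:
  assumes x: "x \<in> S" and s: "in_state x s"
  obtains l r where "s + int (n div 2) - int n < l" "l \<le> s" "s \<le> r" "r \<le> s + int (n div 2)"
    "r - l \<le> int k" "\<And>y. y \<in> box x (separating s) \<Longrightarrow> \<exists>t\<in>{l..r}. in_state y t"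
proof -
  define c where "c = int (n div 2)"
  have c: "0 \<le> c" "c < int n" unfolding c_def using n_pos by auto
  \<comment> \<open>The positions nearest to \<open>s\<close>, to the right and to the left, that
    ignore \<open>j\<close>.\<close>
  define \<beta> where "\<beta> j = Min ({s..s + c} \<inter> {i. j \<notin> V i})" for j
  define \<alpha> where "\<alpha> j = Max ({s + c - int n..s - 1} \<inter> {i. j \<notin> V i})" for j
  have \<beta>: "s \<le> \<beta> j" "\<beta> j \<le> s + c" "j \<notin> V (\<beta> j)" if "j \<in> separating s" for j
  proof -
    have "\<beta> j \<in> ({s..s + c} \<inter> {i. j \<notin> V i})" unfolding \<beta>_def
      using that by (intro Min_in) (auto simp: separating_def c_def)
    then show "s \<le> \<beta> j" "\<beta> j \<le> s + c" "j \<notin> V (\<beta> j)" by auto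
  qed
  have \<alpha>: "s + c - int n \<le> \<alpha> j" "\<alpha> j < s" "j \<notin> V (\<alpha> j)" if "j \<in> separating s" for j
  proof -
    have "\<alpha> j \<in> ({s + c - int n..s - 1} \<inter> {i. j \<notin> V i})" unfolding \<alpha>_def
      using that by (intro Max_in) (auto simp: separating_def c_def)
    then show "s + c - int n \<le> \<alpha> j" "\<alpha> j < s" "j \<notin> V (\<alpha> j)" by auto
  qed
  have fin: "finite (separating s)" unfolding separating_def using finJ by simp
  have main: "\<exists>l r. s + c - int n < l \<and> l \<le> s \<and> s \<le> r \<and> r \<le> s + c \<and>
      (\<forall>y\<in>box x P. \<exists>t\<in>{l..r}. in_state y t) \<and> (l = r \<or> (\<exists>j\<in>P. \<forall>i\<in>{l..<r}. j \<in> V i))"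
    if "finite P" "P \<subseteq> separating s" for P
    using that
    \<comment> \<open>Inputs are released by increasing length of the arc they are confined to: then a position
      ignored by the new input is still constant, so that \<open>box_states\<close> applies.\<close>
  proof (induction P rule: finite_ranking_induct[where f = "\<lambda>j. \<beta> j - \<alpha> j"])
    case empty
    have "box x {} \<subseteq> {x}" unfolding box_def by auto
    then show ?case using s c by (intro exI[of _ s]) auto
  next
    case (insert p P)
    have "P \<subseteq> separating s" using insert.prems by simp
    from insert.IH[OF this] obtain l r where IH: "s + c - int n < l" "l \<le> s" "s \<le> r" "r \<le> s + c"
      "\<And>y. y \<in> box x P \<Longrightarrow> \<exists>t\<in>{l..r}. in_state y t"
      "l = r \<or> (\<exists>j\<in>P. \<forall>i\<in>{l..<r}. j \<in> V i)" by blast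
    have p: "p \<in> separating s" using insert.prems by simp
    \<comment> \<open>If both failed, then \<open>\<beta> p - \<alpha> p < r - l\<close>, which is
      less than the same difference for the earlier input \<open>j\<close> spanning \<open>l\<close>
      to \<open>r\<close>. This contradicts the order of release.\<close>
    have outside: "\<alpha> p < l \<or> r \<le> \<beta> p"
    proof (cases "l = r")
      case True
      then show ?thesis using IH \<beta>(1)[OF p] by linarith
    next
      case False
      then obtain j where j: "j \<in> P" "\<forall>i\<in>{l..<r}. j \<in> V i" using IH(6) by blast
      have js: "j \<in> separating s" using insert.prems j(1) by auto
      have "\<alpha> j < l" "r \<le> \<beta> j" using \<alpha>[OF js] \<beta>[OF js] j(2) IH(2,3) by (auto simp: not_le[symmetric])
      then show ?thesis using insert.hyps(2)[OF j(1)] by linarith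
    qed
    \<comment> \<open>A position ignored by \<open>p\<close> with bit 0: either
      \<open>\<beta> p\<close>, if no state exceeds it, or else \<open>\<alpha> p\<close>, whose bit
      is constantly 1 and is negated by the shift by \<open>n\<close>.\<close>
    define g where "g = (if r \<le> \<beta> p then \<beta> p else \<alpha> p + int n)"
    have gs: "g - int n < s" "s \<le> g" unfolding g_def using \<alpha>[OF p] \<beta>[OF p] c by auto
    have const: "\<not> b g y" if y: "y \<in> box x (insert p P)" for y
    proof -
      \<comment> \<open>Resetting \<open>p\<close> leads back to the previous box and preserves
        every bit that ignores \<open>p\<close>.\<close>
      let ?z = "\<lambda>j. if j \<in> {p} then x j else y j"
      have yS: "y \<in> S" using y unfolding box_def by simp
      have zS: "?z \<in> S" by (rule mix_closedD[OF mix x yS])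
      then have "?z \<in> box x P" using y unfolding box_def by auto
      from IH(5)[OF this] obtain t where t: "l \<le> t" "t \<le> r" "in_state ?z t" by auto
      have eq: "b i y = b i ?z" if "p \<notin> V i" for i
        by (rule depends_onlyD[OF dep yS zS]) (use that in auto)
      show ?thesis
      proof (cases "r \<le> \<beta> p")
        case True
        then show ?thesis using in_state_bit[OF t(3), of "\<beta> p"] eq[OF \<beta>(3)[OF p]] \<beta>[OF p] t IH(1)
          unfolding g_def by auto
      next
        case False
        then have "b (\<alpha> p) ?z" using outside in_state_bit[OF t(3), of "\<alpha> p"] \<alpha>[OF p] t IH(4) by auto
        then show ?thesis using eq[OF \<alpha>(3)[OF p]] bit_periodic[OF yS] False unfolding g_def by auto
      qed
    qed
    obtain l' r' where H: "g - int n < l'" "l' \<le> r'" "r' \<le> g"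
      "\<And>y. y \<in> box x (insert p P) \<Longrightarrow> \<exists>t\<in>{l'..r'}. in_state y t"
      "l' = r' \<or> (\<exists>j\<in>insert p P. \<forall>i\<in>{l'..<r'}. j \<in> V i)"
      using box_states[OF x const] by blast
    have "x \<in> box x (insert p P)" using x unfolding box_def by simp
    from H(4)[OF this] obtain t where t: "l' \<le> t" "t \<le> r'" "in_state x t" by auto
    have "t = s" using in_state_unique[OF t(3) s] t H gs by linarith
    then have ls: "l' \<le> s" "s \<le> r'" using t by auto
    have "s + c - int n < l' \<and> r' \<le> s + c"
    proof (cases "l' = r'")
      case True
      then show ?thesis using ls c by linarith
    next
      case False
      then obtain j where j: "j \<in> insert p P" "\<forall>i\<in>{l'..<r'}. j \<in> V i" using H(5) by blast
      have js: "j \<in> separating s" using insert.prems j(1) by auto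
      have "\<alpha> j < l'" "r' \<le> \<beta> j"
        using \<alpha>[OF js] \<beta>[OF js] j(2) ls by (auto simp: not_le[symmetric])
      then show ?thesis using \<alpha>[OF js] \<beta>[OF js] by linarith
    qed
    then show ?case using ls H(4,5) by blast
  qed
  obtain l r where H: "s + c - int n < l" "l \<le> s" "s \<le> r" "r \<le> s + c"
    "\<And>y. y \<in> box x (separating s) \<Longrightarrow> \<exists>t\<in>{l..r}. in_state y t"
    "l = r \<or> (\<exists>j\<in>separating s. \<forall>i\<in>{l..<r}. j \<in> V i)"
    using main[OF fin] by blast
  have "r - l \<le> int k"
  proof (rule ccontr)
    assume *: "\<not> r - l \<le> int k"
    then have "l \<noteq> r" by auto
    then obtain j where j: "j \<in> separating s" "\<forall>i\<in>{l..<r}. j \<in> V i" using H(6) by blast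
    moreover have "j \<in> J" using j(1) unfolding separating_def by simp
    ultimately show False using gap[of j l] * by force
  qed
  then show ?thesis using that H unfolding c_def by blast
qed

text \<open>An input failing at both places reads a whole arc at each. Up to multiples of
  \<open>n\<close>, these two arcs always cover \<open>k + 1\<close> consecutive positions, against
  \<open>gap\<close>.\<close>

lemma separating_cover:
  assumes j: "j \<in> J"
  shows "j \<in> separating s \<or> j \<in> separating (s + int k + 1)"
proof (rule ccontr)
  define c where "c = int (n div 2)"
  define N where "N i \<longleftrightarrow> j \<notin> V i" for i
  have c: "2 * c \<le> int n" "int n \<le> 2 * c + 1" unfolding c_def by auto
  have kn: "4 * int k + 3 \<le> 3 * int n" "3 * int n < 4 * int k + 7" using k_le k_ge by linarith+
  have per: "N (i - int n) = N i" for i using V_periodic[of "i - int n"] unfolding N_def by simp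
  assume "\<not> ?thesis"
  \<comment> \<open>The letters name the arcs read entirely, right or left, at \<open>s\<close> and
    at \<open>s + k + 1\<close>.\<close>
  then consider
      (rr) "\<And>i. s \<le> i \<Longrightarrow> i \<le> s + c \<Longrightarrow> \<not> N i"
        "\<And>i. s + k + 1 \<le> i \<Longrightarrow> i \<le> s + k + 1 + c \<Longrightarrow> \<not> N i"
    | (rl) "\<And>i. s \<le> i \<Longrightarrow> i \<le> s + c \<Longrightarrow> \<not> N i"
        "\<And>i. s + k + 1 + c - n \<le> i \<Longrightarrow> i \<le> s + k \<Longrightarrow> \<not> N i"
    | (lr) "\<And>i. s + c - n \<le> i \<Longrightarrow> i \<le> s - 1 \<Longrightarrow> \<not> N i"
        "\<And>i. s + k + 1 \<le> i \<Longrightarrow> i \<le> s + k + 1 + c \<Longrightarrow> \<not> N i"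
    | (ll) "\<And>i. s + c - n \<le> i \<Longrightarrow> i \<le> s - 1 \<Longrightarrow> \<not> N i"
        "\<And>i. s + k + 1 + c - n \<le> i \<Longrightarrow> i \<le> s + k \<Longrightarrow> \<not> N i"
    using j unfolding separating_def N_def c_def by (auto simp: algebra_simps)
  then show False
  proof cases
    case rr
    obtain i where i: "s + k + 1 - n \<le> i" "i \<le> s + k + 1 - n + k" "N i"
      using gap[OF j, of "s + k + 1 - n"] unfolding N_def by auto
    show False using rr(1)[of i] rr(2)[of "i + n"] per[of "i + n"] i c kn by (cases "i < s") auto
  next
    case rl
    obtain i where i: "s \<le> i" "i \<le> s + k" "N i" using gap[OF j, of s] unfolding N_def by auto
    show False using rl(1)[of i] rl(2)[of i] i c kn by (cases "i \<le> s + c") auto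
  next
    case lr
    obtain i where i: "s + c \<le> i" "i \<le> s + c + k" "N i"
      using gap[OF j, of "s + c"] unfolding N_def by auto
    show False using lr(1)[of "i - n"] lr(2)[of i] per[of i] i c kn by (cases "i < s + n") auto
  next
    case ll
    obtain i where i: "s + c + k + 1 - n \<le> i" "i \<le> s + c + k + 1 - n + k" "N i"
      using gap[OF j, of "s + c + k + 1 - n"] unfolding N_def by auto
    show False using ll(1)[of "i - n"] ll(2)[of i] per[of i] i c kn by (cases "i \<le> s + k") auto
  qed
qed

lemma impossible: False
proof -
  have "\<exists>x l r. x \<in> S \<and> in_state x s \<and> s + int (n div 2) - int n < l \<and> l \<le> s \<and> s \<le> r \<and>
      r \<le> s + int (n div 2) \<and> r - l \<le> int k \<and> (\<forall>y\<in>box x (separating s). \<exists>t\<in>{l..r}. in_state y t)" for s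
  proof -
    obtain x where x: "x \<in> S" "in_state x s" using onto[of s] unfolding in_state_def by blast
    show ?thesis using separating_states[OF x] x by metis
  qed
  then obtain x l r where xlr: "\<And>s. x s \<in> S" "\<And>s. in_state (x s) s" "\<And>s. s + int (n div 2) - int n < l s"
      "\<And>s. l s \<le> s" "\<And>s. s \<le> r s" "\<And>s. r s \<le> s + int (n div 2)" "\<And>s. r s - l s \<le> int k"
      "\<And>s y. y \<in> box (x s) (separating s) \<Longrightarrow> \<exists>t\<in>{l s..r s}. in_state y t" by metis
  have meet: "l (s + int k + 1) \<le> r s" for s
  proof -
    let ?u = "s + int k + 1"
    \<comment> \<open>By \<open>separating_cover\<close>, an input that is not separating at
      \<open>?u\<close> is separating at \<open>s\<close>, so \<open>?y\<close> lies in both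
      boxes.\<close>
    let ?y = "\<lambda>j. if j \<in> separating s then x ?u j else x s j"
    have y: "?y \<in> S" by (rule mix_closedD[OF mix xlr(1) xlr(1)])
    then have "?y \<in> box (x s) (separating s)" unfolding box_def by auto
    from xlr(8)[OF this] obtain t where t: "l s \<le> t" "t \<le> r s" "in_state ?y t" by auto
    have "?y \<in> box (x ?u) (separating ?u)"
    proof -
      have "?y j = x ?u j" if "j \<notin> separating ?u" for j
        using separating_cover[of j s] off[OF xlr(1)[of s] xlr(1)[of ?u], of j] that by auto
      then show ?thesis using y unfolding box_def by auto
    qed
    from xlr(8)[OF this] obtain t' where t': "l ?u \<le> t'" "t' \<le> r ?u" "in_state ?y t'" by auto
    \<comment> \<open>The states lie in ranges of length \<open>n\<close> that are offset by
      \<open>k + 1 \<le> n\<close>, hence less than a full turn apart.\<close>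
    have "t = t'"
      using in_state_unique[OF t(3) t'(3)] t t' xlr(3)[of s] xlr(6)[of s] xlr(3)[of ?u] xlr(6)[of ?u] k_le
      by linarith
    then show ?thesis using t t' by linarith
  qed
  define a where "a s = s - l s" for s
  have step: "a s + 1 \<le> a (s + int k + 1)" for s
    using meet[of s] xlr(7)[of s] unfolding a_def by linarith
  have "int i \<le> a (int i * (int k + 1))" for i
  proof (induction i)
    case 0
    then show ?case using xlr(4)[of 0] unfolding a_def by simp
  next
    case (Suc i)
    then show ?case using step[of "int i * (int k + 1)"] by (simp add: algebra_simps)
  qed
  \<comment> \<open>After \<open>k + 1\<close> steps \<open>a\<close> is at least
    \<open>k + 1\<close>, although it is bounded by \<open>r s - l s \<le> k\<close>.\<close>
  from this[of "Suc k"] show False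
    using xlr(5,7)[of "int (Suc k) * (int k + 1)"] unfolding a_def by simp
qed

end

section \<open>Monotone words as states\<close>

text \<open>Up to \<open>n\<close>, a prefix of \<open>t\<close> ones; beyond \<open>n\<close> the
  ones are erased from the left. States \<open>0\<close> and \<open>2 * n\<close> give the same
  word.\<close>

definition word :: "nat \<Rightarrow> nat \<Rightarrow> nat \<Rightarrow> nat" where
  "word n t = (\<lambda>i\<in>{0..<n}. if i < t \<and> t \<le> i + n then 1 else 0)"

lemma Mon_eq_words: "Mon n = word n ` {..2 * n}"
proof (intro equalityI subsetI)
  fix x assume "x \<in> Mon n"
  then have x: "x \<in> {0..<n} \<rightarrow>\<^sub>E {0, 1}" and
    mono: "mono_on {0..<n} x \<or> antimono_on {0..<n} x" unfolding Mon_def by auto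
  have val: "x i = 0 \<or> x i = 1" if "i < n" for i using x that by (auto simp: PiE_iff)
  have ext: "x i = undefined" if "\<not> i < n" for i using x that by (auto simp: PiE_iff extensional_def)
  show "x \<in> word n ` {..2 * n}"
    using mono
  proof
    assume m: "mono_on {0..<n} x"
    \<comment> \<open>The first 1, with \<open>n\<close> as the default if there is none.\<close>
    define q where "q = (LEAST i. i = n \<or> x i = 1)"
    have q: "q = n \<or> x q = 1" unfolding q_def by (rule LeastI[of _ n]) simp
    have qn: "q \<le> n" unfolding q_def by (rule Least_le) simp
    have below: "x i \<noteq> 1" if "i < q" for i using not_less_Least[of i] that unfolding q_def by blast
    have above: "x i = 1" if "q \<le> i" "i < n" for i
      using monotone_onD[OF m, of q i] q that val[of i] by force
    have "x = word n (n + q)"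
    proof
      fix i show "x i = word n (n + q) i"
        using below[of i] above[of i] val[of i] ext[of i] unfolding word_def by auto
    qed
    then show ?thesis using qn by auto
  next
    assume m: "antimono_on {0..<n} x"
    define q where "q = (LEAST i. i = n \<or> x i = 0)"
    have q: "q = n \<or> x q = 0" unfolding q_def by (rule LeastI[of _ n]) simp
    have qn: "q \<le> n" unfolding q_def by (rule Least_le) simp
    have below: "x i \<noteq> 0" if "i < q" for i using not_less_Least[of i] that unfolding q_def by blast
    have above: "x i = 0" if "q \<le> i" "i < n" for i
      using monotone_onD[OF m, of q i] q that val[of i] by force
    have "x = word n q"
    proof
      fix i show "x i = word n q i"
        using below[of i] above[of i] val[of i] ext[of i] qn unfolding word_def by auto
    qed
    then show ?thesis using qn by auto
  qed
next
  fix x assume "x \<in> word n ` {..2 * n}"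
  then obtain t where x: "x = word n t" by blast
  have "antimono_on {0..<n} x" if "t \<le> n"
    using that unfolding x word_def by (auto intro!: monotone_onI)
  moreover have "mono_on {0..<n} x" if "n \<le> t"
    using that unfolding x word_def by (auto intro!: monotone_onI)
  moreover have "x \<in> {0..<n} \<rightarrow>\<^sub>E {0, 1}" unfolding x word_def by auto
  ultimately show "x \<in> Mon n" unfolding Mon_def using nat_le_linear[of t n] by blast
qed

text \<open>Each turn of \<open>i\<close> lowers the quotient on the right by one; its parity
  matches the negations counted by \<open>i div int n\<close>.\<close>

lemma word_extended_bit:
  assumes n: "0 < n" and t: "t \<le> 2 * n"
  shows "(word n t (nat (i mod int n)) = 1 \<longleftrightarrow> even (i div int n)) \<longleftrightarrow> even ((int t - 1 - i) div int n)"
proof -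
  define m where "m = i mod int n"
  have m: "0 \<le> m" "m < int n" unfolding m_def using n by auto
  have i: "i = i div int n * int n + m" unfolding m_def by simp
  have "(int t - 1 - i) div int n = (int t - 1 - m) div int n - i div int n"
  proof -
    have eq: "int t - 1 - i = (int t - 1 - m) + (- (i div int n)) * int n" using i by (simp add: algebra_simps)
    show ?thesis unfolding eq by (subst div_mult_self1) (use n in simp_all)
  qed
  moreover have "even ((int t - 1 - m) div int n) \<longleftrightarrow> m < t \<and> t \<le> m + n"
  proof -
    consider "t \<le> m" | "m < t" "t \<le> m + n" | "m + n < t" by linarith
    then show ?thesis
    proof cases
      case 1
      then have "(int t - 1 - m) div int n = -1"
        using m by (intro int_div_pos_eq[of _ _ _ "int t - 1 - m + n"]) auto
      then show ?thesis using 1 by auto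
    next
      case 2
      then have "(int t - 1 - m) div int n = 0" by (intro div_pos_pos_trivial) auto
      then show ?thesis using 2 by auto
    next
      case 3
      then have "(int t - 1 - m) div int n = 1"
        using m t by (intro int_div_pos_eq[of _ _ _ "int t - 1 - m - n"]) auto
      then show ?thesis using 3 by auto
    qed
  qed
  moreover have "word n t (nat m) = 1 \<longleftrightarrow> m < t \<and> t \<le> m + n"
    using m unfolding word_def by (auto simp: nat_less_iff)
  ultimately show ?thesis unfolding m_def[symmetric] by auto
qed

lemma card_cyclic_interval:
  assumes "k < n"
  shows "card (cyclic_interval n a (a + int k)) = Suc k"
proof -
  have "cyclic_interval n a (a + int k) = (\<lambda>c. nat (c mod int n)) ` {a..a + int k}"
    using assms unfolding cyclic_interval_def by auto
  moreover have "inj_on (\<lambda>c. nat (c mod int n)) {a..a + int k}"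
  proof (rule inj_onI)
    fix c d assume cd: "c \<in> {a..a + int k}" "d \<in> {a..a + int k}" "nat (c mod int n) = nat (d mod int n)"
    then have "c mod int n = d mod int n" using assms by (simp add: eq_nat_nat_iff)
    then have "int n dvd c - d" by (simp add: mod_eq_dvd_iff)
    then show "c = d" using cd assms zdvd_imp_le[of "int n" "c - d"] zdvd_imp_le[of "int n" "d - c"]
      by (cases c d rule: linorder_cases) (auto simp: dvd_diff_commute)
  qed
  ultimately show ?thesis by (simp add: card_image)
qed

text \<open>Without such a simplex no input is read at \<open>k + 1\<close> consecutive positions,
  which is the \<open>gap\<close> of \<open>cyclic_process\<close>.\<close>

lemma long_interval_simplex:
  assumes n: "n \<ge> 1" and gen: "generates {0, 1} {0..<n} K (Mon n)"
  shows "\<exists>a. cyclic_interval n a (a + int ((3 * n - 3) div 4)) \<in> K"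
proof (rule ccontr)
  assume no: "\<not> ?thesis"
  \<comment> \<open>The largest \<open>k\<close> with \<open>4 * k + 3 \<le> 3 * n\<close>.\<close>
  define k where "k = (3 * n - 3) div 4"
  have k: "4 * k + 3 \<le> 3 * n" "3 * n < 4 * k + 7" unfolding k_def using n by linarith+
  obtain B J :: "nat set" and f where fin: "finite B" "finite J"
    and f: "f ` (J \<rightarrow>\<^sub>E B) = Mon n" "communication_complex {0..<n} B J f \<subseteq> K"
    using gen unfolding generates_def by blast
  define pos where "pos i = nat (i mod int n)" for i
  have pos: "pos i < n" for i unfolding pos_def using n by (simp add: nat_less_iff)
  define V where "V i = input_window B J f (pos i)" for i
  define b where "b i x \<longleftrightarrow> (f x (pos i) = 1 \<longleftrightarrow> even (i div int n))" for i x
  have win: "determines B J f i (input_window B J f i)" for i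
    by (rule input_window_least(1)[OF fin(2)])
  have bit: "b i x \<longleftrightarrow> even ((int t - 1 - i) div int n)" if "f x = word n t" "t \<le> 2 * n" for i x t
    using word_extended_bit[of n t i] that n unfolding b_def pos_def by simp
  interpret cyclic_process n k J "J \<rightarrow>\<^sub>E B" b V
  proof
    show "finite J" by fact
    show "mix_closed (J \<rightarrow>\<^sub>E B)" unfolding mix_closed_def by (auto simp: PiE_iff extensional_def)
    show "x j = y j" if "x \<in> J \<rightarrow>\<^sub>E B" "y \<in> J \<rightarrow>\<^sub>E B" "j \<notin> J" for x y j
      using that by (auto simp: PiE_iff extensional_def)
    show "V i \<subseteq> J" for i using determines_subset[OF win] unfolding V_def .
    show "depends_only (J \<rightarrow>\<^sub>E B) (V i) (b i)" for i
      using win[of "pos i"] unfolding depends_only_def b_def V_def determines_def by metis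
    show "V (i + int n) = V i" for i unfolding V_def pos_def by simp
    show "\<exists>t. \<forall>i. b i x \<longleftrightarrow> even ((t - 1 - i) div int n)" if x: "x \<in> J \<rightarrow>\<^sub>E B" for x
    proof -
      have "f x \<in> word n ` {..2 * n}" using x f(1) Mon_eq_words by blast
      then show ?thesis using bit by blast
    qed
    show "\<exists>x\<in>J \<rightarrow>\<^sub>E B. \<forall>i. b i x \<longleftrightarrow> even ((t - 1 - i) div int n)" for t
    proof -
      \<comment> \<open>Reducing the state modulo \<open>2 * n\<close> changes the quotients by even
        numbers only.\<close>
      define u where "u = nat (t mod (2 * int n))"
      have u: "int u = t mod (2 * int n)" unfolding u_def using n by simp
      then have "u \<le> 2 * n" using n pos_mod_bound[of "2 * int n" t] by linarith
      moreover from this have "word n u \<in> f ` (J \<rightarrow>\<^sub>E B)" unfolding f(1) Mon_eq_words by simp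
      then obtain x where "x \<in> J \<rightarrow>\<^sub>E B" "f x = word n u" by auto
      moreover have "even ((int u - 1 - i) div int n) \<longleftrightarrow> even ((t - 1 - i) div int n)" for i
      proof -
        have "t = int u + 2 * int n * (t div (2 * int n))" unfolding u by simp
        then have eq: "t - 1 - i = (int u - 1 - i) + (2 * (t div (2 * int n))) * int n"
          by (simp add: algebra_simps)
        show ?thesis unfolding eq by (subst div_mult_self1) (use n in simp_all)
      qed
      ultimately show ?thesis using bit by metis
    qed
    show "\<exists>i\<in>{a..a + int k}. j \<notin> V i" if j: "j \<in> J" for j a
    proof (rule ccontr)
      assume *: "\<not> ?thesis"
      have "cyclic_interval n a (a + int k) \<subseteq> {0..<n} \<inter> {i. j \<in> input_window B J f i}"
        using * k pos unfolding cyclic_interval_def V_def pos_def by auto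
      then have "cyclic_interval n a (a + int k) \<in> communication_complex {0..<n} B J f"
        unfolding communication_complex_def by blast
      then show False using no f(2) unfolding k_def by blast
    qed
    show "4 * k + 3 \<le> 3 * n" "3 * n < 4 * k + 7" by fact+
  qed
  show False by (rule impossible)
qed

subsection \<open>Upper bound\<close>

text \<open>
  Eight marks cut the circle of 2n states into arcs of length about n/4. Each of the four inputs
  carries one of three symbols and a number. The symbols select a cell: a value v < 8 stands for the
  mark v, and 8 + i for the arc between the marks i and i + 1. The number of input (i + 1) mod 4 gives
  the position within that arc. The table was found with a SAT solver. Its defining property is
  that a change of the symbol of input d alone never crosses the arcs d and d + 4.
\<close>

definition cell_table :: "nat list" where
  "cell_table = [
    5, 6, 13, 4, 5, 4, 4, 6, 4,
    5, 6, 13, 11, 11, 11, 5, 6, 12,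
    4, 7, 13, 3, 2, 3, 3, 8, 3,
    5, 14, 6, 4, 14, 4, 4, 14, 4,
    5, 7, 6, 3, 1, 3, 5, 7, 12,
    10, 0, 0, 10, 1, 2, 10, 8, 2,
    15, 15, 15, 9, 0, 2, 1, 0, 2,
    7, 7, 6, 9, 1, 3, 7, 7, 12,
    1, 0, 0, 9, 1, 2, 1, 8, 2]"

definition cell :: "(nat \<Rightarrow> nat) \<Rightarrow> nat" where
  "cell g = cell_table ! (27 * g 0 + 9 * g 1 + 3 * g 2 + g 3)"

definition first_mark :: "nat \<Rightarrow> nat" where
  "first_mark v = (if v < 8 then v else v - 8)"

text \<open>No reduction modulo 8: the last arc ends at mark 8, which gives the same word as mark
  0.\<close>

definition last_mark :: "nat \<Rightarrow> nat" where
  "last_mark v = (if v < 8 then v else v - 7)"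

text \<open>A cell is \<open>beyond d\<close> if it lies on the part of the circle where the bits of quarter d are all 1,
  and \<open>opposite d\<close> if they are all 0.\<close>

definition beyond :: "nat \<Rightarrow> nat \<Rightarrow> bool" where
  "beyond d v \<longleftrightarrow> d + 1 \<le> first_mark v \<and> last_mark v \<le> d + 4"

definition opposite :: "nat \<Rightarrow> nat \<Rightarrow> bool" where
  "opposite d v \<longleftrightarrow> last_mark v \<le> d \<or> d + 5 \<le> first_mark v"

text \<open>Three ways for quarter \<open>d\<close> not to notice a change of input
  \<open>d\<close>: same cell with its number not taken from input \<open>d\<close>, bits all 1 in
  both cells, or bits all 0 in both.\<close>

definition compatible :: "nat \<Rightarrow> nat \<Rightarrow> nat \<Rightarrow> bool" where
  "compatible d v w \<longleftrightarrow> v = w \<and> (v < 8 \<or> (v + 1) mod 4 \<noteq> d) \<or> beyond d v \<and> beyond d w \<or>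
     opposite d v \<and> opposite d w"


text \<open>Exhaustive check over four symbols and a replacement \<open>z\<close> for the changed
  one.\<close>

lemma cell_table_compatible:
  "\<forall>a\<in>set [0,1,2]. \<forall>b\<in>set [0,1,2]. \<forall>c\<in>set [0,1,2]. \<forall>e\<in>set [0,1,2]. \<forall>z\<in>set [0,1,2].
     compatible 0 (cell_table ! (27 * a + 9 * b + 3 * c + e)) (cell_table ! (27 * z + 9 * b + 3 * c + e)) \<and>
     compatible 1 (cell_table ! (27 * a + 9 * b + 3 * c + e)) (cell_table ! (27 * a + 9 * z + 3 * c + e)) \<and>
     compatible 2 (cell_table ! (27 * a + 9 * b + 3 * c + e)) (cell_table ! (27 * a + 9 * b + 3 * z + e)) \<and>
     compatible 3 (cell_table ! (27 * a + 9 * b + 3 * c + e)) (cell_table ! (27 * a + 9 * b + 3 * c + z))"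
  by code_simp


lemma cell_table_arcs: "length cell_table = 81" "\<forall>v\<in>set cell_table. v < 16"
  "\<forall>i\<in>set [0,1,2,3,4,5,6,7]. 8 + i \<in> set cell_table"
  by code_simp+

lemma cell_compatible:
  assumes g: "\<And>j. j < 4 \<Longrightarrow> g j < 3" and h: "\<And>j. j < 4 \<Longrightarrow> h j < 3"
    and d: "d < 4" and eq: "\<And>j. j < 4 \<Longrightarrow> j \<noteq> d \<Longrightarrow> g j = h j"
  shows "compatible d (cell g) (cell h)"
proof -
  have mem: "g 0 \<in> set [0,1,2]" "g 1 \<in> set [0,1,2]" "g 2 \<in> set [0,1,2]" "g 3 \<in> set [0,1,2]"
    "h d \<in> set [0,1,2]"
    using g[of 0] g[of 1] g[of 2] g[of 3] h[OF d] by auto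
  note C = cell_table_compatible[THEN bspec, OF mem(1), THEN bspec, OF mem(2), THEN bspec, OF mem(3),
      THEN bspec, OF mem(4), THEN bspec, OF mem(5)]
  consider "d = 0" | "d = 1" | "d = 2" | "d = 3" using d by linarith
  then show ?thesis
    by cases (use C eq[of 0] eq[of 1] eq[of 2] eq[of 3] in \<open>simp_all add: cell_def\<close>)
qed

lemma cell_less:
  assumes "\<And>j. j < 4 \<Longrightarrow> g j < 3"
  shows "cell g < 16"
proof -
  have "27 * g 0 + 9 * g 1 + 3 * g 2 + g 3 < length cell_table"
    using assms[of 0] assms[of 1] assms[of 2] assms[of 3] cell_table_arcs(1) by simp
  from nth_mem[OF this] show ?thesis using cell_table_arcs(2) unfolding cell_def by blast
qed

text \<open>Serves surjectivity: every state, marks included, lies on a closed arc.\<close>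

lemma cell_arc_exists:
  assumes "i < 8"
  obtains g where "\<And>j. g j < 3" "cell g = 8 + i"
proof -
  have "i \<in> set [0,1,2,3,4,5,6,7]" using assms by auto
  then have "8 + i \<in> set cell_table" using cell_table_arcs(3) by blast
  then obtain q where q: "q < 81" "cell_table ! q = 8 + i"
    by (auto simp: in_set_conv_nth cell_table_arcs(1))
  \<comment> \<open>The ternary digits of the index, most significant first.\<close>
  define g where "g j = q div 3 ^ (3 - j) mod 3" for j
  have "g 0 = q div 27 mod 3" "g 1 = q div 9 mod 3" "g 2 = q div 3 mod 3" "g 3 = q mod 3"
    unfolding g_def by simp_all
  moreover have "q div 3 div 3 = q div 9" "q div 9 div 3 = q div 27" "q div 27 mod 3 = q div 27"
    using q(1) by (simp_all add: div_mult2_eq[symmetric])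
  ultimately have "27 * g 0 + 9 * g 1 + 3 * g 2 + g 3 = q"
    using div_mult_mod_eq[of q 3] div_mult_mod_eq[of "q div 3" 3] div_mult_mod_eq[of "q div 9" 3]
    by linarith
  then have "cell g = 8 + i" using q(2) unfolding cell_def by simp
  moreover have "g j < 3" for j unfolding g_def by simp
  ultimately show ?thesis using that by blast
qed

section \<open>From marks to words\<close>

text \<open>Marks serve both as states and as ends of the quarters
  \<open>{mark n d..<mark n (Suc d)}\<close>. Rounding down leaves at least \<open>n div 4\<close>
  positions in each quarter.\<close>

definition mark :: "nat \<Rightarrow> nat \<Rightarrow> nat" where
  "mark n i = i * n div 4"

lemma mark_simps [simp]: "mark n 0 = 0" "mark n 4 = n" "mark n 8 = 2 * n"
  unfolding mark_def by simp_all

lemma mark_add_4: "mark n (i + 4) = mark n i + n"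
  unfolding mark_def add_mult_distrib by simp

lemma mark_mono: "i \<le> j \<Longrightarrow> mark n i \<le> mark n j"
  unfolding mark_def by (intro div_le_mono mult_le_mono1)

lemma mark_Suc: "mark n i + n div 4 \<le> mark n (Suc i)"
  unfolding mark_def mult_Suc by linarith

lemma mark_interval:
  assumes "t \<le> mark n m" "0 < m"
  obtains i where "i < m" "mark n i \<le> t" "t \<le> mark n (Suc i)"
proof -
  have "\<exists>i<m. mark n i \<le> t \<and> t \<le> mark n (Suc i)" using assms
  proof (induction m)
    case (Suc m)
    show ?case
    proof (cases "t \<le> mark n m \<and> 0 < m")
      case True
      then obtain i where "i < m" "mark n i \<le> t \<and> t \<le> mark n (Suc i)" using Suc.IH by blast
      then show ?thesis by (intro exI[of _ i]) simp
    next
      case False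
      then have "mark n m \<le> t" by auto
      then show ?thesis using Suc.prems by (intro exI[of _ m]) simp
    qed
  qed simp
  then show ?thesis using that by blast
qed

lemma mark_interval_less:
  assumes "i < n"
  obtains d where "d < 4" "mark n d \<le> i" "i < mark n (Suc d)"
proof -
  have "\<exists>d. i < mark n (Suc d)" using assms by (intro exI[of _ 3]) simp
  then have 1: "i < mark n (Suc (LEAST d. i < mark n (Suc d)))" by (rule LeastI_ex)
  define d where "d = (LEAST d. i < mark n (Suc d))"
  have "d \<le> 3" unfolding d_def using assms by (intro Least_le) simp
  moreover have "mark n d \<le> i"
  proof (cases d)
    case (Suc e)
    then have "\<not> i < mark n (Suc e)" using not_less_Least[of e "\<lambda>d. i < mark n (Suc d)"] unfolding d_def by simp
    then show ?thesis using Suc by simp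
  qed simp
  ultimately show ?thesis using that[of d] 1 unfolding d_def by simp
qed

text \<open>The \<open>min\<close> clips the number to the arc, so that every input vector gives a
  state.\<close>

definition position :: "nat \<Rightarrow> (nat \<Rightarrow> nat \<times> nat) \<Rightarrow> nat" where
  "position n x = (let v = cell (\<lambda>j. fst (x j)) in
     if v < 8 then mark n v
     else mark n (v - 8) + min (snd (x ((v + 1) mod 4))) (mark n (v - 7) - mark n (v - 8)))"

lemma position_bounds:
  "mark n (first_mark (cell (\<lambda>j. fst (x j)))) \<le> position n x"
  "position n x \<le> mark n (last_mark (cell (\<lambda>j. fst (x j))))"
  using mark_mono[OF diff_le_mono2[of 7 8 "cell (\<lambda>j. fst (x j))"], of n]
  unfolding position_def first_mark_def last_mark_def by (auto simp: Let_def)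

text \<open>The bit at \<open>i\<close> is 1 from state \<open>i + 1\<close> to state
  \<open>i + n\<close>, and the marks \<open>d + 1\<close> to \<open>d + 4\<close> lie in this range
  for each \<open>i\<close> in quarter \<open>d\<close>.\<close>

lemma word_beyond:
  assumes "beyond d v" "mark n (first_mark v) \<le> t" "t \<le> mark n (last_mark v)"
    "mark n d \<le> i" "i < mark n (Suc d)" "i < n"
  shows "word n t i = 1"
  using assms mark_mono[of "Suc d" "first_mark v" n] mark_mono[of "last_mark v" "d + 4" n] mark_add_4[of n d]
  unfolding word_def beyond_def by auto

lemma word_opposite:
  assumes "opposite d v" "mark n (first_mark v) \<le> t" "t \<le> mark n (last_mark v)"
    "mark n d \<le> i" "i < mark n (Suc d)" "i < n"
  shows "word n t i = 0"
proof -
  have "mark n (d + 5) = mark n (Suc d) + n" using mark_add_4[of n "Suc d"] by (simp add: add.commute)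
  then show ?thesis
    using assms mark_mono[of "last_mark v" d n] mark_mono[of "d + 5" "first_mark v" n]
    unfolding word_def opposite_def by auto
qed

lemma word_position_cong:
  assumes x: "x \<in> {0..<4} \<rightarrow>\<^sub>E {0..<3} \<times> {0..n}" and y: "y \<in> {0..<4} \<rightarrow>\<^sub>E {0..<3} \<times> {0..n}"
    and d: "d < 4" and eq: "\<And>j. j < 4 \<Longrightarrow> j \<noteq> d \<Longrightarrow> x j = y j"
    and i: "mark n d \<le> i" "i < mark n (Suc d)" "i < n"
  shows "word n (position n x) i = word n (position n y) i"
proof -
  let ?v = "cell (\<lambda>j. fst (x j))" and ?w = "cell (\<lambda>j. fst (y j))"
  have "compatible d ?v ?w"
    by (rule cell_compatible[OF _ _ d]) (use x y eq in \<open>force simp: PiE_iff\<close>)+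
  then consider "?v = ?w" "?v < 8 \<or> (?v + 1) mod 4 \<noteq> d" | "beyond d ?v" "beyond d ?w"
    | "opposite d ?v" "opposite d ?w" unfolding compatible_def by blast
  then show ?thesis
  proof cases
    case 1
    then have "position n x = position n y"
      using eq[of "(?v + 1) mod 4"] unfolding position_def by (auto simp: Let_def)
    then show ?thesis by simp
  next
    case 2
    then show ?thesis using word_beyond[OF _ position_bounds i] by simp
  next
    case 3
    then show ?thesis using word_opposite[OF _ position_bounds i] by simp
  qed
qed

lemma words_from_positions:
  "(\<lambda>x. word n (position n x)) ` ({0..<4} \<rightarrow>\<^sub>E {0..<3} \<times> {0..n}) = Mon n"
proof (intro equalityI subsetI)
  fix w assume "w \<in> (\<lambda>x. word n (position n x)) ` ({0..<4} \<rightarrow>\<^sub>E {0..<3} \<times> {0..n})"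
  then obtain x where x: "x \<in> {0..<4} \<rightarrow>\<^sub>E {0..<3} \<times> {0..n}" "w = word n (position n x)" by blast
  have "cell (\<lambda>j. fst (x j)) < 16" by (rule cell_less) (use x(1) in \<open>force simp: PiE_iff\<close>)
  then have "last_mark (cell (\<lambda>j. fst (x j))) \<le> 8" unfolding last_mark_def by auto
  then have "position n x \<le> 2 * n" using position_bounds(2)[of n x] mark_mono[of _ 8 n] by fastforce
  then show "w \<in> Mon n" unfolding x(2) Mon_eq_words by simp
next
  fix w assume "w \<in> Mon n"
  then obtain t where t: "t \<le> mark n 8" "w = word n t" unfolding Mon_eq_words by auto
  obtain i where i: "i < 8" "mark n i \<le> t" "t \<le> mark n (Suc i)"
    using mark_interval[OF t(1)] by auto
  obtain g where g: "\<And>j. g j < 3" "cell g = 8 + i" using cell_arc_exists[OF i(1)] by blast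
  \<comment> \<open>All inputs carry the same number, so it does not matter which one the cell
    selects.\<close>
  define x where "x = (\<lambda>j\<in>{0..<4::nat}. (g j, t - mark n i))"
  have "mark n (Suc i) \<le> mark n i + n" using mark_add_4[of n i] mark_mono[of "Suc i" "i + 4" n] by simp
  then have "x \<in> {0..<4} \<rightarrow>\<^sub>E {0..<3} \<times> {0..n}" unfolding x_def using g(1) i by auto
  moreover have "cell (\<lambda>j. fst (x j)) = 8 + i" using g(2) unfolding cell_def x_def by simp
  then have "position n x = t" using i unfolding position_def by (simp add: x_def Let_def Suc_diff_le)
  ultimately show "w \<in> (\<lambda>x. word n (position n x)) ` ({0..<4} \<rightarrow>\<^sub>E {0..<3} \<times> {0..n})"
    using t(2) by blast
qed

text \<open>The complex generated by the complements of the four quarters.\<close>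

definition quarter_avoiding :: "nat \<Rightarrow> nat set set" where
  "quarter_avoiding n = {T. T \<subseteq> {0..<n} \<and> (\<exists>d<4. T \<inter> {mark n d..<mark n (Suc d)} = {})}"

lemma card_quarter_avoiding:
  assumes "T \<in> quarter_avoiding n"
  shows "card T \<le> n - n div 4"
proof -
  obtain d where d: "d < 4" "T \<subseteq> {0..<n} - {mark n d..<mark n (Suc d)}"
    using assms unfolding quarter_avoiding_def by blast
  have "mark n (Suc d) \<le> n" using mark_mono[of "Suc d" 4 n] d(1) by simp
  then have "card ({0..<n} - {mark n d..<mark n (Suc d)}) = n - (mark n (Suc d) - mark n d)"
    by (subst card_Diff_subset) auto
  then show ?thesis using card_mono[OF _ d(2)] mark_Suc[of n d] by simp
qed

text \<open>Positions sharing input \<open>d\<close> lie outside quarter \<open>d\<close>, whose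
  bits are determined by the other inputs (\<open>word_position_cong\<close>).\<close>

lemma quarter_avoiding_generates: "generates {0, 1} {0..<n} (quarter_avoiding n) (Mon n)"
proof -
  let ?B = "{0..<3::nat} \<times> {0..n}" and ?J = "{0..<4::nat}" and ?f = "\<lambda>x. word n (position n x)"
  show ?thesis
  proof (rule generates_any_type)
    show "language {0, 1} {0..<n} (Mon n)" unfolding language_def Mon_def by auto
    show "simplicial_complex {0..<n} (quarter_avoiding n)"
      unfolding simplicial_complex_def
    proof (intro conjI ballI allI impI)
      show "quarter_avoiding n \<subseteq> Pow {0..<n}" unfolding quarter_avoiding_def by blast
      have "(0::nat) < 4" by simp
      then show "{} \<in> quarter_avoiding n" unfolding quarter_avoiding_def by blast
      show "T \<in> quarter_avoiding n" if "S \<in> quarter_avoiding n" "T \<subseteq> S" for S T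
        using that unfolding quarter_avoiding_def by blast
    qed
    show "finite ?B" "finite ?J" by simp_all
    show "?f ` (?J \<rightarrow>\<^sub>E ?B) = Mon n" by (rule words_from_positions)
    show "communication_complex {0..<n} ?B ?J ?f \<subseteq> quarter_avoiding n"
    proof
      fix T assume "T \<in> communication_complex {0..<n} ?B ?J ?f"
      then have T: "T \<subseteq> {0..<n}" and "(\<Inter>i\<in>T. input_window ?B ?J ?f i) \<noteq> {}"
        by (simp_all add: communication_complex_def)
      then obtain d where "d \<in> (\<Inter>i\<in>T. input_window ?B ?J ?f i)" 
        by (elim ex_in_conv[THEN iffD2, THEN exE])
      then have d: "d \<in> input_window ?B ?J ?f i" if "i \<in> T" for i using that by (rule INT_D)
      show "T \<in> quarter_avoiding n"
      \<comment> \<open>An empty intersection is \<open>UNIV\<close>; only for nonempty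
        \<open>T\<close> is \<open>d\<close> known to be one of the four inputs.\<close>
      proof (cases "T = {}")
        case True
        have "(0::nat) < 4" by simp
        then show ?thesis using True unfolding quarter_avoiding_def by blast
      next
        case False
        then obtain i where "i \<in> T" by blast
        have "input_window ?B ?J ?f i \<subseteq> ?J"
          by (rule determines_subset[OF input_window_least(1)]) simp
        then have "d \<in> ?J" using d[OF \<open>i \<in> T\<close>] by (rule subsetD)
        then have d4: "d < 4" by simp
        have avoid: "i \<notin> T" if i: "mark n d \<le> i" "i < mark n (Suc d)" for i
        proof
          assume "i \<in> T"
          then have "i < n" using T by auto
          have "determines ?B ?J ?f i (?J - {d})"
            unfolding determines_def
          proof (intro conjI ballI impI)
            show "?J - {d} \<subseteq> ?J" by blast
            fix x y assume "x \<in> ?J \<rightarrow>\<^sub>E ?B" "y \<in> ?J \<rightarrow>\<^sub>E ?B" "\<forall>j\<in>?J - {d}. x j = y j"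
            then show "?f x i = ?f y i" by (intro word_position_cong[OF _ _ d4 _ i \<open>i < n\<close>]) simp_all
          qed
          with _ have "input_window ?B ?J ?f i \<subseteq> ?J - {d}" by (rule input_window_least(2)) simp
          then have "d \<in> ?J - {d}" using d[OF \<open>i \<in> T\<close>] by (rule subsetD)
          then show False by simp
        qed
        have "T \<inter> {mark n d..<mark n (Suc d)} = {}" 
          unfolding disjoint_iff using avoid by (metis atLeastLessThan_iff)
        then show ?thesis unfolding quarter_avoiding_def using T d4 by blast
      qed
    qed
  qed
qed

theorem theorem7p2:
  fixes n :: nat
  assumes "n \<ge> 1"
  shows "\<lfloor>(3 * real n + 1) / 4\<rfloor> \<le> int (mu n) \<and> int (mu n) \<le> \<lceil>3 * real n / 4\<rceil>"
proof -
  define bounded where "bounded k \<longleftrightarrow> (\<exists>K. generates {0, 1} {0..<n} K (Mon n) \<and>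
      (\<forall>S\<in>K. (\<exists>a b. S = cyclic_interval n a b) \<longrightarrow> card S \<le> k))" for k
  have mu: "mu n = (LEAST k. bounded k)" unfolding mu_def bounded_def ..
  have upper: "bounded (n - n div 4)"
    using quarter_avoiding_generates card_quarter_avoiding unfolding bounded_def by blast
  have "bounded (mu n)" unfolding mu using upper by (rule LeastI)
  then obtain K where K: "generates {0, 1} {0..<n} K (Mon n)"
    "\<And>a b. cyclic_interval n a b \<in> K \<Longrightarrow> card (cyclic_interval n a b) \<le> mu n"
    unfolding bounded_def by blast
  have "Suc ((3 * n - 3) div 4) \<le> mu n"
  proof -
    obtain a where a: "cyclic_interval n a (a + int ((3 * n - 3) div 4)) \<in> K"
      using long_interval_simplex[OF assms K(1)] by blast
    have "(3 * n - 3) div 4 < n" using assms by linarith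
    from card_cyclic_interval[OF this] show ?thesis using K(2)[OF a] by simp
  qed
  \<comment> \<open>For \<open>n \<ge> 1\<close>, \<open>Suc ((3 * n - 3) div 4)\<close> equals
    \<open>(3 * n + 1) div 4\<close>.\<close>
  then have "(3 * n + 1) div 4 \<le> mu n" using assms by linarith
  moreover have "\<lfloor>(3 * real n + 1) / 4\<rfloor> = int ((3 * n + 1) div 4)"
    using floor_divide_of_nat_eq[where ?'a = real, of "3 * n + 1" 4] by (simp add: add.commute)
  moreover have "mu n \<le> n - n div 4" unfolding mu using upper by (rule Least_le)
  moreover have "int (n - n div 4) \<le> \<lceil>3 * real n / 4\<rceil>"
  proof -
    have "real (n - n div 4) < 3 * real n / 4 + 1" by linarith
    then show ?thesis by linarith
  qed
  ultimately show ?thesis by linarith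
qed

end
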